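(* For every positive integer $n$, the expected down degree of a uniformly random permutation in $S_n$ is $$E_{\pi\in S_n}[d_{-}(\pi)]=\sum_{i=2}^n\sum_{j=2}^i\sum_{k=2}^j\frac{1}{i\cdot(k-1)}=(n+1)\sum_{i=1}^n\frac1i-2n.$$
   Context: $S_n$ is the symmetric group on $\{1,\dots,n\}$, and $E_{\pi\in S_n}$ denotes the expectation over $\pi$ uniformly distributed in $S_n$. For $1\le a<b\le n$, $t_{a,b}\in S_n$ is the transposition interchanging $a$ and $b$; $t_{a,b}\pi$ is obtained from $\pi=[\pi(1),\dots,\pi(n)]$ by interchanging the values $a$ and $b$. The length $\ell(\pi)$ is the minimal $k$ such that $\pi$ is a product of $k$ adjacent transpositions $s_i=t_{i,i+1}$ ($1\le i<n$). The down degree of $\pi$ is the number of permutations covered by $\pi$ in the strong Bruhat order on $S_n$; equivalently $d_{-}(\pi)=\#\{t_{a,b} \mid 1\le a<b\le n,\ \ell(t_{a,b}\pi)=\ell(\pi)-1\}$. *)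

theory Defs
  imports "HOL-Combinatorics.Permutations" "HOL-Probability.Probability_Mass_Function"
begin

text \<open>
  The elements of \<open>S\<^sub>n\<close> are the functions \<open>\<pi> :: nat \<Rightarrow> nat\<close> with \<open>\<pi> permutes {1..n}\<close>.
  Products are compositions, so \<open>transpose a b \<circ> \<pi>\<close> interchanges the values \<open>a\<close> and \<open>b\<close>.
  The name \<open>transpose\<close> is qualified because matrices and lists also have one.
\<close>

definition sym_group :: "nat \<Rightarrow> (nat \<Rightarrow> nat) set" where
  "sym_group n = {\<pi>. \<pi> permutes {1..n}}"

text \<open>
  \<open>apply_adj_transps is\<close> is the product of the \<open>transpose i (Suc i)\<close> for \<open>i\<close> in the list \<open>is\<close>;
  the value below is meaningful only for \<open>\<pi> \<in> sym_group n\<close>.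
\<close>

definition perm_length :: "nat \<Rightarrow> (nat \<Rightarrow> nat) \<Rightarrow> nat" where
  "perm_length n \<pi> =
     (LEAST k. \<exists>is. length is = k \<and> set is \<subseteq> {1..<n} \<and> apply_adj_transps is = \<pi>)"

text \<open>
  The strict strong Bruhat order is the transitive closure of
  multiplication by a transposition that increases the length.
\<close>

definition bruhat_step :: "nat \<Rightarrow> (nat \<Rightarrow> nat) \<Rightarrow> (nat \<Rightarrow> nat) \<Rightarrow> bool" where
  "bruhat_step n \<sigma> \<tau> \<longleftrightarrow>
     \<sigma> \<in> sym_group n \<and>
     (\<exists>a b. 1 \<le> a \<and> a < b \<and> b \<le> n \<and> \<tau> = Transposition.transpose a b \<circ> \<sigma>) \<and>
     perm_length n \<sigma> < perm_length n \<tau>"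

definition bruhat_less :: "nat \<Rightarrow> (nat \<Rightarrow> nat) \<Rightarrow> (nat \<Rightarrow> nat) \<Rightarrow> bool" where
  "bruhat_less n = (bruhat_step n)\<^sup>+\<^sup>+"

definition bruhat_covered_by :: "nat \<Rightarrow> (nat \<Rightarrow> nat) \<Rightarrow> (nat \<Rightarrow> nat) \<Rightarrow> bool" where
  "bruhat_covered_by n \<sigma> \<tau> \<longleftrightarrow>
     bruhat_less n \<sigma> \<tau> \<and> (\<nexists>\<rho>. bruhat_less n \<sigma> \<rho> \<and> bruhat_less n \<rho> \<tau>)"

definition down_degree :: "nat \<Rightarrow> (nat \<Rightarrow> nat) \<Rightarrow> nat" where
  "down_degree n \<pi> = card {\<sigma> \<in> sym_group n. bruhat_covered_by n \<sigma> \<pi>}"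

end

theory Submission
  imports Defs
begin

text \<open>
  The length of a permutation is its number of inversions. If \<open>\<tau>\<close> has an inversion at the
  positions \<open>p < q\<close>, then exchanging the entries there removes this inversion, and it removes two
  more for every position \<open>r\<close> between \<open>p\<close> and \<open>q\<close> whose value \<open>\<tau> r\<close> lies between \<open>\<tau> q\<close> and
  \<open>\<tau> p\<close>. If there is no such \<open>r\<close>, the length drops by exactly one and the result is covered
  by \<open>\<tau>\<close>; if there is one, the exchange factors into three exchanges that each shorten the
  permutation, so the result is not covered. Hence the down degree of \<open>\<tau>\<close> counts the inverted
  pairs of positions with no position and value strictly between
  (\<open>down_degree_eq_card_cover_positions\<close>).

  By linearity of expectation it remains to find the probability that a given pair \<open>p < q\<close> is such
  a pair, i.e. that \<open>\<pi> q\<close> and \<open>\<pi> p\<close> are consecutive, in this order, among the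
  \<open>m = q - p + 1\<close> values in the window \<open>{p..q}\<close>. A permutation always has \<open>m - 1\<close> consecutive pairs
  of values in the window, and by symmetry they are equally likely to sit at each of the
  \<open>m * (m - 1)\<close> ordered pairs of distinct positions. So the probability is \<open>1 / m\<close>
  (\<open>card_consecutive_at\<close>).

  The pairs with right end \<open>q\<close> therefore contribute \<open>1 / 2 + \<dots> + 1 / q = H\<^sub>q - 1\<close>, where
  \<open>H\<^sub>q\<close> is the harmonic number. Summing over \<open>q\<close> gives the closed form. The summand of
  the triple sum for \<open>i\<close> also equals \<open>H\<^sub>i - 1\<close>, because
  \<open>H\<^sub>1 + \<dots> + H\<^bsub>i-1\<^esub> = i * (H\<^sub>i - 1)\<close>.
\<close>

section \<open>Inversions and the length function\<close>

definition inversions :: "nat \<Rightarrow> (nat \<Rightarrow> nat) \<Rightarrow> (nat \<times> nat) set" where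
  "inversions n \<sigma> = {(i, j). 1 \<le> i \<and> i < j \<and> j \<le> n \<and> \<sigma> j < \<sigma> i}"

lemma finite_inversions [simp]: "finite (inversions n \<sigma>)"
  by (rule finite_subset[of _ "{1..n} \<times> {1..n}"]) (auto simp: inversions_def)

text \<open>
  To compare the inversions of \<open>\<sigma>\<close> and \<open>\<sigma> \<circ> t\<close>, where \<open>t\<close> exchanges \<open>p\<close> and \<open>q\<close>, one would like
  to move each pair of positions by \<open>t\<close>. This can destroy the order of the pair, in which case the
  pair is left alone. Either way the map is an involution on ordered pairs, which is why it is
  injective.
\<close>

definition sort_swap :: "nat \<Rightarrow> nat \<Rightarrow> nat \<times> nat \<Rightarrow> nat \<times> nat" where
  "sort_swap p q = (\<lambda>(i, j). let t = Transposition.transpose p q in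
     if t i < t j then (t i, t j) else (i, j))"

lemma inj_on_sort_swap: "inj_on (sort_swap p q) {(i, j). i < j}"
proof (rule inj_on_inverseI)
  fix x :: "nat \<times> nat"
  assume "x \<in> {(i, j). i < j}"
  then show "sort_swap p q (sort_swap p q x) = x"
    by (auto simp: sort_swap_def Let_def)
qed

lemma sort_swap_eq_swapped_pair:
  assumes "p < q" "i < j" "sort_swap p q (i, j) = (p, q)"
  shows "(i, j) = (p, q)"
  using assms by (auto simp: sort_swap_def Let_def Transposition.transpose_def split: if_splits)

text \<open>
  If \<open>t\<close> keeps \<open>(i, j)\<close> in order, \<open>(t i, t j)\<close> is an inversion of \<open>\<sigma> \<circ> t\<close> because the values agree.
  Otherwise \<open>i = p\<close> or \<open>j = q\<close>, and the exchange only raises the value at \<open>p\<close> and lowers the one at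
  \<open>q\<close>, so \<open>(i, j)\<close> stays inverted.
\<close>

lemma sort_swap_image_inversions:
  assumes pq: "1 \<le> p" "p < q" "q \<le> n" and less: "\<sigma> p < \<sigma> q"
  shows "sort_swap p q ` inversions n \<sigma>
           \<subseteq> inversions n (\<sigma> \<circ> Transposition.transpose p q) - {(p, q)}"
proof (rule image_subsetI)
  fix x assume "x \<in> inversions n \<sigma>"
  then obtain i j where x: "x = (i, j)" and ij: "1 \<le> i" "i < j" "j \<le> n" "\<sigma> j < \<sigma> i"
    by (auto simp: inversions_def)
  have "sort_swap p q (i, j) \<in> inversions n (\<sigma> \<circ> Transposition.transpose p q)"
    using pq less ij
    by (auto simp: sort_swap_def Let_def inversions_def Transposition.transpose_def split: if_splits)
  moreover have "sort_swap p q (i, j) \<noteq> (p, q)"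
    using sort_swap_eq_swapped_pair[of p q i j] pq less ij by auto
  ultimately show "sort_swap p q x
      \<in> inversions n (\<sigma> \<circ> Transposition.transpose p q) - {(p, q)}"
    by (simp add: x)
qed

lemma swapped_pair_inversion:
  assumes "1 \<le> p" "p < q" "q \<le> n" "\<sigma> p < \<sigma> q"
  shows "(p, q) \<in> inversions n (\<sigma> \<circ> Transposition.transpose p q)"
  using assms by (auto simp: inversions_def)

lemma card_sort_swap_image:
  "card (sort_swap p q ` inversions n \<sigma>) = card (inversions n \<sigma>)"
  by (rule card_image, rule inj_on_subset[OF inj_on_sort_swap]) (auto simp: inversions_def)

lemma card_inversions_less:
  assumes "1 \<le> p" "p < q" "q \<le> n" "\<sigma> p < \<sigma> q"
  shows "card (inversions n \<sigma>) < card (inversions n (\<sigma> \<circ> Transposition.transpose p q))"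
proof -
  have "sort_swap p q ` inversions n \<sigma> \<subset> inversions n (\<sigma> \<circ> Transposition.transpose p q)"
    using sort_swap_image_inversions[OF assms] swapped_pair_inversion[OF assms] by blast
  from psubset_card_mono[OF finite_inversions this] show ?thesis
    by (simp add: card_sort_swap_image)
qed

text \<open>
  The inversions of \<open>\<sigma> \<circ> t\<close> missed by the injection are \<open>(p, q)\<close> and the pairs \<open>(p, r)\<close> and
  \<open>(r, q)\<close> that the exchange creates; the latter need a value \<open>\<sigma> r\<close> between \<open>\<sigma> p\<close> and \<open>\<sigma> q\<close>.
\<close>

lemma card_inversions_Suc:
  assumes pq: "1 \<le> p" "p < q" "q \<le> n" "\<sigma> p < \<sigma> q"
    and gap: "\<And>r. p < r \<Longrightarrow> r < q \<Longrightarrow> \<sigma> r < \<sigma> p \<or> \<sigma> q < \<sigma> r"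
  shows "card (inversions n (\<sigma> \<circ> Transposition.transpose p q)) = Suc (card (inversions n \<sigma>))"
proof -
  let ?I = "inversions n (\<sigma> \<circ> Transposition.transpose p q)"
  have "?I - {(p, q)} \<subseteq> sort_swap p q ` inversions n \<sigma>"
  proof clarify
    fix i j assume ij: "(i, j) \<in> ?I" "(i, j) \<notin> sort_swap p q ` inversions n \<sigma>"
    have "sort_swap p q (i, j) \<notin> inversions n \<sigma>"
    proof
      assume "sort_swap p q (i, j) \<in> inversions n \<sigma>"
      moreover have "i < j" using ij(1) by (simp add: inversions_def)
      then have "(i, j) = sort_swap p q (sort_swap p q (i, j))"
        by (simp add: sort_swap_def Let_def)
      ultimately show False using ij(2) by (metis image_eqI)
    qed
    then show "i = p \<and> j = q"
      using ij(1) pq gap[of i] gap[of j]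
      by (auto simp: sort_swap_def Let_def inversions_def Transposition.transpose_def split: if_splits)
  qed
  then have "?I - {(p, q)} = sort_swap p q ` inversions n \<sigma>"
    using sort_swap_image_inversions[OF pq] by blast
  then have "card (?I - {(p, q)}) = card (inversions n \<sigma>)"
    by (simp add: card_sort_swap_image)
  then show ?thesis
    using swapped_pair_inversion[OF pq] by (metis card_Suc_Diff1 finite_inversions)
qed

lemma comp_transpose_cancel:
  "\<sigma> \<circ> Transposition.transpose p q \<circ> Transposition.transpose p q = \<sigma>"
  by (simp add: fun_eq_iff)

text \<open>
  Nothing lies strictly between two adjacent positions, so an adjacent transposition changes the
  number of inversions by exactly one.
\<close>

lemma card_inversions_le_word_length:
  assumes "set is \<subseteq> {1..<n}"
  shows "card (inversions n (apply_adj_transps is)) \<le> length is"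
  using assms
proof (induction "is" rule: rev_induct)
  case Nil
  have "inversions n id = {}" by (auto simp: inversions_def)
  then show ?case by (simp only: apply_adj_transps_Nil card.empty)
next
  case (snoc i "is")
  let ?\<sigma> = "apply_adj_transps is" and ?t = "Transposition.transpose i (Suc i)"
  have i: "1 \<le> i" "Suc i \<le> n" using snoc.prems by auto
  have "?\<sigma> permutes {1..n}"
    using snoc.prems by (intro permutes_apply_adj_transps) auto
  then have "inj ?\<sigma>" by (rule permutes_inj)
  then have "?\<sigma> i < ?\<sigma> (Suc i) \<or> ?\<sigma> (Suc i) < ?\<sigma> i"
    by (metis injD linorder_neqE_nat n_not_Suc_n)
  then have "card (inversions n (?\<sigma> \<circ> ?t)) \<le> Suc (card (inversions n ?\<sigma>))"
  proof
    assume "?\<sigma> i < ?\<sigma> (Suc i)"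
    with card_inversions_Suc[of i "Suc i" n ?\<sigma>] i show ?thesis by simp
  next
    assume "?\<sigma> (Suc i) < ?\<sigma> i"
    with card_inversions_less[of i "Suc i" n "?\<sigma> \<circ> ?t"] i
    show ?thesis by (simp add: comp_transpose_cancel)
  qed
  also have "\<dots> \<le> Suc (length is)" using snoc by simp
  finally show ?case by (simp only: apply_adj_transps_snoc length_append_singleton Suc_eq_plus1)
qed

lemma permutes_no_descent_imp_id:
  assumes perm: "\<sigma> permutes {1..n::nat}"
    and asc: "\<And>i. 1 \<le> i \<Longrightarrow> i < n \<Longrightarrow> \<sigma> i < \<sigma> (Suc i)"
  shows "\<sigma> = id"
proof -
  have "i \<le> \<sigma> i" if "1 \<le> i" "i \<le> n" for i
    using that
  proof (induction i rule: dec_induct)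
    case base
    then show ?case using permutes_in_seg[OF perm, of 1] by simp
  next
    case (step i)
    with asc[of i] show ?case by simp
  qed
  then show ?thesis using permutes_natset_ge[OF perm] by simp
qed

text \<open>Bubble sort: undoing a descent at adjacent positions removes exactly one inversion.\<close>

lemma exists_word_of_inversion_length:
  assumes "\<sigma> permutes {1..n}"
  shows "\<exists>is. length is = card (inversions n \<sigma>) \<and> set is \<subseteq> {1..<n} \<and> apply_adj_transps is = \<sigma>"
  using assms
proof (induction "card (inversions n \<sigma>)" arbitrary: \<sigma> rule: less_induct)
  case less
  show ?case
  proof (cases "\<sigma> = id")
    case True
    have "inversions n id = {}" by (auto simp: inversions_def)
    with True show ?thesis by (intro exI[of _ "[]"]) simp
  next
    case False
    then obtain i where i: "1 \<le> i" "i < n" "\<not> \<sigma> i < \<sigma> (Suc i)"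
      using permutes_no_descent_imp_id[OF less.prems] by blast
    have "\<sigma> i \<noteq> \<sigma> (Suc i)"
      using permutes_inj[OF less.prems] by (metis injD n_not_Suc_n)
    with i have desc: "\<sigma> (Suc i) < \<sigma> i" by simp
    let ?t = "Transposition.transpose i (Suc i)"
    have card: "card (inversions n \<sigma>) = Suc (card (inversions n (\<sigma> \<circ> ?t)))"
      using card_inversions_Suc[of i "Suc i" n "\<sigma> \<circ> ?t"] i desc
      by (simp add: comp_transpose_cancel)
    have "\<sigma> \<circ> ?t permutes {1..n}"
      using i less.prems by (intro permutes_compose permutes_swap_id) auto
    with less.hyps card obtain "is" where
      "length is = card (inversions n (\<sigma> \<circ> ?t))" "set is \<subseteq> {1..<n}"
      "apply_adj_transps is = \<sigma> \<circ> ?t"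
      by (metis lessI)
    with card i show ?thesis
      by (intro exI[of _ "is @ [i]"]) (simp add: comp_transpose_cancel)
  qed
qed

lemma perm_length_eq_card_inversions:
  assumes "\<sigma> \<in> sym_group n"
  shows "perm_length n \<sigma> = card (inversions n \<sigma>)"
  unfolding perm_length_def
proof (rule Least_equality)
  show "\<exists>is. length is = card (inversions n \<sigma>) \<and> set is \<subseteq> {1..<n} \<and> apply_adj_transps is = \<sigma>"
    using exists_word_of_inversion_length assms by (simp add: sym_group_def)
qed (use card_inversions_le_word_length in blast)

section \<open>Covers in the Bruhat order\<close>

lemma sym_group_comp_transpose:
  assumes "\<sigma> \<in> sym_group n" "1 \<le> p" "p < q" "q \<le> n"
  shows "\<sigma> \<circ> Transposition.transpose p q \<in> sym_group n"
  using assms unfolding sym_group_def by (auto intro!: permutes_compose permutes_swap_id)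

lemma sym_group_eq_iff:
  assumes "\<sigma> \<in> sym_group n"
  shows "\<sigma> i = \<sigma> j \<longleftrightarrow> i = j"
  using assms permutes_inj unfolding sym_group_def by (auto dest: injD)

lemma perm_length_comp_transpose_less_iff:
  assumes "\<sigma> \<in> sym_group n" "1 \<le> p" "p < q" "q \<le> n"
  shows "perm_length n \<sigma> < perm_length n (\<sigma> \<circ> Transposition.transpose p q) \<longleftrightarrow> \<sigma> p < \<sigma> q"
proof -
  have "\<sigma> p \<noteq> \<sigma> q" using assms by (simp add: sym_group_eq_iff)
  then consider "\<sigma> p < \<sigma> q" | "\<sigma> q < \<sigma> p" by linarith
  then show ?thesis
  proof cases
    case 1
    with card_inversions_less[OF assms(2-4) 1] show ?thesis
      using perm_length_eq_card_inversions assms sym_group_comp_transpose[OF assms] by simp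
  next
    case 2
    with card_inversions_less[OF assms(2-4), of "\<sigma> \<circ> Transposition.transpose p q"] show ?thesis
      using perm_length_eq_card_inversions assms sym_group_comp_transpose[OF assms]
      by (simp add: comp_transpose_cancel)
  qed
qed

text \<open>
  Exchanging two values is exchanging the positions that carry them. In terms of positions, the
  length condition becomes a comparison of two entries.
\<close>

lemma bruhat_step_iff:
  "bruhat_step n \<sigma> \<tau> \<longleftrightarrow> \<sigma> \<in> sym_group n \<and>
     (\<exists>p q. 1 \<le> p \<and> p < q \<and> q \<le> n \<and> \<sigma> p < \<sigma> q \<and> \<tau> = \<sigma> \<circ> Transposition.transpose p q)"
  (is "?L \<longleftrightarrow> ?R")
proof
  assume ?L
  then obtain a b where S: "\<sigma> \<in> sym_group n" and ab: "1 \<le> a" "a < b" "b \<le> n"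
    and \<tau>: "\<tau> = Transposition.transpose a b \<circ> \<sigma>" and len: "perm_length n \<sigma> < perm_length n \<tau>"
    unfolding bruhat_step_def by blast
  from S have perm: "\<sigma> permutes {1..n}" by (simp add: sym_group_def)
  have "a \<in> \<sigma> ` {1..n}" "b \<in> \<sigma> ` {1..n}"
    unfolding permutes_image[OF perm] using ab by auto
  then obtain u v where uv: "u \<in> {1..n}" "v \<in> {1..n}" "\<sigma> u = a" "\<sigma> v = b"
    by blast
  define p q where "p = min u v" and "q = max u v"
  have pq: "1 \<le> p" "p < q" "q \<le> n"
    using uv ab less_le by (auto simp: p_def q_def min_def max_def)
  have "Transposition.transpose a b \<circ> \<sigma> = \<sigma> \<circ> Transposition.transpose u v"
    using uv sym_group_eq_iff[OF S] by (auto simp: fun_eq_iff Transposition.transpose_def)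
  also have "\<dots> = \<sigma> \<circ> Transposition.transpose p q"
    by (auto simp: p_def q_def min_def max_def transpose_commute)
  finally have "\<tau> = \<sigma> \<circ> Transposition.transpose p q" using \<tau> by simp
  with S pq len perm_length_comp_transpose_less_iff[OF S pq] show ?R by auto
next
  assume ?R
  then obtain p q where S: "\<sigma> \<in> sym_group n" and pq: "1 \<le> p" "p < q" "q \<le> n"
    and less: "\<sigma> p < \<sigma> q" and \<tau>: "\<tau> = \<sigma> \<circ> Transposition.transpose p q" by blast
  from S have perm: "\<sigma> permutes {1..n}" by (simp add: sym_group_def)
  have "\<tau> = Transposition.transpose (\<sigma> p) (\<sigma> q) \<circ> \<sigma>"
    using sym_group_eq_iff[OF S] by (auto simp: \<tau> fun_eq_iff Transposition.transpose_def)
  moreover have "1 \<le> \<sigma> p" "\<sigma> q \<le> n"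
    using permutes_in_seg[OF perm] pq by auto
  ultimately show ?L
    using S less pq perm_length_comp_transpose_less_iff[OF S pq] \<tau>
    unfolding bruhat_step_def by metis
qed

lemma bruhat_step_comp_transpose:
  assumes "\<sigma> \<in> sym_group n" "1 \<le> p" "p < q" "q \<le> n" "\<sigma> p < \<sigma> q"
  shows "bruhat_step n \<sigma> (\<sigma> \<circ> Transposition.transpose p q)"
  unfolding bruhat_step_iff using assms by blast

lemma bruhat_less_imp_perm_length_less:
  "bruhat_less n \<sigma> \<tau> \<Longrightarrow> perm_length n \<sigma> < perm_length n \<tau>"
  unfolding bruhat_less_def by (induction rule: tranclp_induct) (auto simp: bruhat_step_def)

text \<open>
  These are the inversions with no point of the graph of \<open>\<tau>\<close> in the interior of the rectangle
  that they span.
\<close>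

definition cover_positions :: "nat \<Rightarrow> (nat \<Rightarrow> nat) \<Rightarrow> (nat \<times> nat) set" where
  "cover_positions n \<tau> = {(p, q). 1 \<le> p \<and> p < q \<and> q \<le> n \<and> \<tau> q < \<tau> p \<and>
     \<not> (\<exists>r. p < r \<and> r < q \<and> \<tau> q < \<tau> r \<and> \<tau> r < \<tau> p)}"

text \<open>
  With \<open>x < y < z\<close> the values of \<open>\<sigma>\<close> at \<open>p\<close>, \<open>r\<close>, \<open>q\<close>, the chain is
  \<open>xyz < yxz < zxy < zyx\<close>: exchange the positions \<open>p, r\<close>, then \<open>p, q\<close>, then \<open>r, q\<close>.
\<close>

lemma bruhat_less_between:
  assumes S: "\<sigma> \<in> sym_group n" and pq: "1 \<le> p" "p < r" "r < q" "q \<le> n"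
    and less: "\<sigma> p < \<sigma> r" "\<sigma> r < \<sigma> q"
  shows "\<exists>\<rho>. bruhat_less n \<sigma> \<rho> \<and> bruhat_less n \<rho> (\<sigma> \<circ> Transposition.transpose p q)"
proof -
  define \<rho> where "\<rho> = \<sigma> \<circ> Transposition.transpose p r"
  define \<rho>' where "\<rho>' = \<rho> \<circ> Transposition.transpose p q"
  have \<rho>: "bruhat_step n \<sigma> \<rho>"
    unfolding \<rho>_def using assms by (intro bruhat_step_comp_transpose) auto
  have \<rho>_S: "\<rho> \<in> sym_group n"
    unfolding \<rho>_def using assms by (intro sym_group_comp_transpose) auto
  have \<rho>': "bruhat_step n \<rho> \<rho>'"
    unfolding \<rho>'_def using assms \<rho>_S
    by (intro bruhat_step_comp_transpose) (auto simp: \<rho>_def Transposition.transpose_def)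
  have "\<rho>' \<in> sym_group n"
    unfolding \<rho>'_def using assms \<rho>_S by (intro sym_group_comp_transpose) auto
  moreover have "\<sigma> \<circ> Transposition.transpose p q = \<rho>' \<circ> Transposition.transpose r q"
    unfolding \<rho>'_def \<rho>_def using pq by (auto simp: fun_eq_iff Transposition.transpose_def)
  moreover have "\<rho>' r < \<rho>' q"
    unfolding \<rho>'_def \<rho>_def using pq less by (auto simp: Transposition.transpose_def)
  ultimately have "bruhat_step n \<rho>' (\<sigma> \<circ> Transposition.transpose p q)"
    using pq by (auto intro!: bruhat_step_comp_transpose)
  with \<rho> \<rho>' show ?thesis unfolding bruhat_less_def
    by (meson tranclp.r_into_trancl tranclp.trancl_into_trancl)
qed

lemma bruhat_covered_by_iff:
  assumes T: "\<tau> \<in> sym_group n"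
  shows "\<sigma> \<in> sym_group n \<and> bruhat_covered_by n \<sigma> \<tau> \<longleftrightarrow>
    (\<exists>(p, q) \<in> cover_positions n \<tau>. \<sigma> = \<tau> \<circ> Transposition.transpose p q)" (is "?L \<longleftrightarrow> ?R")
proof
  assume L: ?L
  then have less: "bruhat_less n \<sigma> \<tau>" and min: "\<And>\<rho>. bruhat_less n \<sigma> \<rho> \<Longrightarrow> \<not> bruhat_less n \<rho> \<tau>"
    by (auto simp: bruhat_covered_by_def)
  \<comment> \<open>A chain of two or more steps would pass through an element strictly between.\<close>
  have "bruhat_step n \<sigma> \<tau>"
    using less min unfolding bruhat_less_def
    by (metis tranclp.r_into_trancl tranclp.cases)
  then obtain p q where S: "\<sigma> \<in> sym_group n" and pq: "1 \<le> p" "p < q" "q \<le> n"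
    and lt: "\<sigma> p < \<sigma> q" and \<tau>: "\<tau> = \<sigma> \<circ> Transposition.transpose p q"
    by (auto simp: bruhat_step_iff)
  have "\<not> (\<exists>r. p < r \<and> r < q \<and> \<sigma> p < \<sigma> r \<and> \<sigma> r < \<sigma> q)"
    using bruhat_less_between[OF S pq(1) _ _ pq(3)] min \<tau> by blast
  then have "(p, q) \<in> cover_positions n \<tau>"
    using pq lt by (auto simp: cover_positions_def \<tau> Transposition.transpose_def)
  moreover have "\<sigma> = \<tau> \<circ> Transposition.transpose p q" by (simp add: \<tau> comp_transpose_cancel)
  ultimately show ?R by blast
next
  assume ?R
  then obtain p q where pq: "1 \<le> p" "p < q" "q \<le> n" and lt: "\<tau> q < \<tau> p"
    and gap: "\<not> (\<exists>r. p < r \<and> r < q \<and> \<tau> q < \<tau> r \<and> \<tau> r < \<tau> p)"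
    and \<sigma>: "\<sigma> = \<tau> \<circ> Transposition.transpose p q"
    by (auto simp: cover_positions_def)
  have S: "\<sigma> \<in> sym_group n" using T pq \<sigma> sym_group_comp_transpose by simp
  have \<tau>: "\<tau> = \<sigma> \<circ> Transposition.transpose p q" by (simp add: \<sigma> comp_transpose_cancel)
  have step: "bruhat_step n \<sigma> \<tau>"
    unfolding \<tau> using lt by (intro bruhat_step_comp_transpose S pq) (simp add: \<sigma>)
  have "\<sigma> r < \<sigma> p \<or> \<sigma> q < \<sigma> r" if "p < r" "r < q" for r
    using that gap sym_group_eq_iff[OF T, of r p] sym_group_eq_iff[OF T, of r q]
    by (auto simp: \<sigma>) (metis linorder_neqE_nat)
  moreover have "\<sigma> p < \<sigma> q" using lt by (simp add: \<sigma>)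
  ultimately have "card (inversions n \<tau>) = Suc (card (inversions n \<sigma>))"
    unfolding \<tau> by (intro card_inversions_Suc pq)
  then have "perm_length n \<tau> = Suc (perm_length n \<sigma>)"
    using perm_length_eq_card_inversions[OF S] perm_length_eq_card_inversions[OF T] by argo
  then have "\<not> (\<exists>\<rho>. bruhat_less n \<sigma> \<rho> \<and> bruhat_less n \<rho> \<tau>)"
    by (metis bruhat_less_imp_perm_length_less less_trans_Suc less_irrefl)
  with S step show ?L
    unfolding bruhat_covered_by_def bruhat_less_def by blast
qed

lemma down_degree_eq_card_cover_positions:
  assumes T: "\<tau> \<in> sym_group n"
  shows "down_degree n \<tau> = card (cover_positions n \<tau>)"
proof -
  let ?f = "\<lambda>(p, q). \<tau> \<circ> Transposition.transpose p q"
  have "{\<sigma> \<in> sym_group n. bruhat_covered_by n \<sigma> \<tau>} = ?f ` cover_positions n \<tau>"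
  proof (rule set_eqI)
    fix \<sigma>
    show "\<sigma> \<in> {\<sigma> \<in> sym_group n. bruhat_covered_by n \<sigma> \<tau>} \<longleftrightarrow> \<sigma> \<in> ?f ` cover_positions n \<tau>"
      unfolding mem_Collect_eq bruhat_covered_by_iff[OF T] by auto
  qed
  moreover have "inj_on ?f (cover_positions n \<tau>)"
  proof (rule inj_onI, clarify)
    fix p q p' q'
    assume "(p, q) \<in> cover_positions n \<tau>" "(p', q') \<in> cover_positions n \<tau>"
      and eq: "\<tau> \<circ> Transposition.transpose p q = \<tau> \<circ> Transposition.transpose p' q'"
    then have "p < q" "p' < q'" by (auto simp: cover_positions_def)
    moreover have "Transposition.transpose p q x = Transposition.transpose p' q' x" for x
      using fun_cong[OF eq, of x] sym_group_eq_iff[OF T] by simp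
    from this[of p] this[of q] have "{p, q} = {p', q'}"
      using \<open>p < q\<close> \<open>p' < q'\<close> by (auto simp: Transposition.transpose_def split: if_splits)
    ultimately show "p = p' \<and> q = q'" by (auto simp: doubleton_eq_iff)
  qed
  ultimately show ?thesis by (simp add: down_degree_def card_image)
qed

section \<open>Consecutive values on a window of positions\<close>

definition consecutive :: "'a::linorder set \<Rightarrow> 'a \<Rightarrow> 'a \<Rightarrow> bool" where
  "consecutive V u v \<longleftrightarrow> u \<in> V \<and> v \<in> V \<and> u < v \<and> \<not> (\<exists>w\<in>V. u < w \<and> w < v)"

text \<open>Every element but the least is the upper end of exactly one consecutive pair.\<close>

lemma card_consecutive_pairs:
  fixes V :: "'a::linorder set"
  assumes fin: "finite V" and ne: "V \<noteq> {}"
  shows "card {(u, v). consecutive V u v} = card V - 1"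
proof -
  have "bij_betw snd {(u, v). consecutive V u v} (V - {Min V})"
  proof (rule bij_betw_imageI)
    show "inj_on snd {(u, v). consecutive V u v}"
      by (auto simp: inj_on_def consecutive_def) (meson linorder_neqE)
    show "snd ` {(u, v). consecutive V u v} = V - {Min V}"
    proof (intro equalityI subsetI)
      fix v assume "v \<in> snd ` {(u, v). consecutive V u v}"
      then show "v \<in> V - {Min V}"
        using fin by (auto simp: consecutive_def) (metis Min_le leD)
    next
      fix v assume v: "v \<in> V - {Min V}"
      let ?B = "{w \<in> V. w < v}"
      have "Min V \<in> ?B" using v fin ne by (auto simp: order_less_le)
      then have B: "finite ?B" "?B \<noteq> {}" using fin by auto
      have "consecutive V (Max ?B) v"
        using Max_in[OF B] Max_ge[OF B(1)] v by (auto simp: consecutive_def) (meson leD)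
      then show "v \<in> snd ` {(u, v). consecutive V u v}" by force
    qed
  qed
  then have "card {(u, v). consecutive V u v} = card (V - {Min V})" by (rule bij_betw_same_card)
  then show ?thesis using fin ne by simp
qed

lemma ex_permutes_two_points:
  assumes "x \<in> W" "y \<in> W" "x' \<in> W" "y' \<in> W" "x \<noteq> y" "x' \<noteq> y'"
  shows "\<exists>\<rho>. \<rho> permutes W \<and> \<rho> x = x' \<and> \<rho> y = y'"
proof -
  define s where "s = Transposition.transpose x x'"
  have s: "s permutes W" "s x = x'" "s y \<in> W" "s y \<noteq> x'"
    using assms by (auto simp: s_def Transposition.transpose_def intro!: permutes_swap_id)
  let ?\<rho> = "Transposition.transpose (s y) y' \<circ> s"
  have "?\<rho> permutes W" using s assms by (intro permutes_compose permutes_swap_id)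
  moreover have "?\<rho> x = x'" "?\<rho> y = y'" using s assms by (auto simp: Transposition.transpose_def)
  ultimately show ?thesis by blast
qed

text \<open>
  Precomposing with a permutation of the window that carries one pair of positions to the other
  does not change the set of values in the window.
\<close>

lemma card_consecutive_at_eq:
  fixes A :: "'a::linorder set"
  assumes W: "W \<subseteq> A" and xy: "x \<in> W" "y \<in> W" "x \<noteq> y" "x' \<in> W" "y' \<in> W" "x' \<noteq> y'"
  shows "card {\<pi>. \<pi> permutes A \<and> consecutive (\<pi> ` W) (\<pi> x) (\<pi> y)}
       = card {\<pi>. \<pi> permutes A \<and> consecutive (\<pi> ` W) (\<pi> x') (\<pi> y')}"
proof -
  obtain \<rho> where \<rho>: "\<rho> permutes W" "\<rho> x = x'" "\<rho> y = y'"
    using ex_permutes_two_points[of x W y x' y'] xy by blast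
  have \<rho>A: "\<rho> permutes A" "inv \<rho> permutes A"
    using \<rho>(1) W permutes_subset permutes_inv by blast+
  have im: "\<rho> ` W = W" "inv \<rho> ` W = W"
    using \<rho>(1) permutes_image permutes_inv by blast+
  have inv: "\<rho> \<circ> inv \<rho> = id" "inv \<rho> \<circ> \<rho> = id" "inv \<rho> x' = x" "inv \<rho> y' = y"
    using permutes_inv_o[OF \<rho>(1)] permutes_inverses(2)[OF \<rho>(1)] \<rho> by auto
  have comp_im: "(\<lambda>z. \<pi> (\<rho> z)) ` W = \<pi> ` W" "(\<lambda>z. \<pi> (inv \<rho> z)) ` W = \<pi> ` W" for \<pi>
    using im by (metis image_image)+
  show ?thesis
    by (rule sym, rule bij_betw_same_card[of "\<lambda>\<pi>. \<pi> \<circ> \<rho>"],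
        rule bij_betw_byWitness[where f' = "\<lambda>\<pi>. \<pi> \<circ> inv \<rho>"])
      (auto simp: inv \<rho> comp_im comp_assoc intro!: permutes_compose \<rho>A)
qed

text \<open>
  Double counting of the permutations together with an ordered pair of positions of \<open>W\<close> that carries
  consecutive values. With \<open>m = card W\<close>, each permutation has \<open>m - 1\<close> such pairs, and each of the
  \<open>m * (m - 1)\<close> pairs occurs equally often. The factor \<open>m - 1\<close>, nonzero because \<open>x\<close> and \<open>y\<close> are
  distinct, cancels.
\<close>

lemma card_consecutive_at:
  fixes A :: "'a::linorder set"
  assumes fin: "finite A" and W: "W \<subseteq> A" and xy: "x \<in> W" "y \<in> W" "x \<noteq> y"
  shows "card W * card {\<pi>. \<pi> permutes A \<and> consecutive (\<pi> ` W) (\<pi> x) (\<pi> y)} = fact (card A)"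
proof -
  let ?P = "{\<pi>. \<pi> permutes A}"
  let ?N = "card {\<pi>. \<pi> permutes A \<and> consecutive (\<pi> ` W) (\<pi> x) (\<pi> y)}"
  let ?D = "{(u, v). u \<in> W \<and> v \<in> W \<and> u \<noteq> v}"
  have finW: "finite W" using fin W finite_subset by blast
  have finP: "finite ?P" using fin by (rule finite_permutations)
  have D: "?D = W \<times> W - (\<lambda>u. (u, u)) ` W" by auto
  have finD: "finite ?D" unfolding D using finW by simp
  have "card ?D = card (W \<times> W) - card ((\<lambda>u. (u, u)) ` W)"
    unfolding D using finW by (intro card_Diff_subset) auto
  then have cardD: "card ?D = card W * (card W - 1)"
    by (simp add: card_image inj_on_def card_cartesian_product algebra_simps)
  have per_perm: "card {e \<in> ?D. consecutive (\<pi> ` W) (\<pi> (fst e)) (\<pi> (snd e))} = card W - 1"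
    if "\<pi> \<in> ?P" for \<pi>
  proof -
    have inj: "inj \<pi>" using that permutes_inj by blast
    have "bij_betw (map_prod \<pi> \<pi>) {e \<in> ?D. consecutive (\<pi> ` W) (\<pi> (fst e)) (\<pi> (snd e))}
        {(u, v). consecutive (\<pi> ` W) u v}"
    proof (rule bij_betw_imageI)
      show "inj_on (map_prod \<pi> \<pi>) {e \<in> ?D. consecutive (\<pi> ` W) (\<pi> (fst e)) (\<pi> (snd e))}"
        using inj by (auto simp: inj_on_def dest: injD)
    qed (force simp: consecutive_def)
    then have "card {e \<in> ?D. consecutive (\<pi> ` W) (\<pi> (fst e)) (\<pi> (snd e))} = card (\<pi> ` W) - 1"
      using finW xy by (subst card_consecutive_pairs[symmetric]) (auto dest: bij_betw_same_card)
    also have "card (\<pi> ` W) = card W" using inj by (meson card_image inj_on_subset subset_UNIV)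
    finally show ?thesis .
  qed
  have "(\<Sum>e\<in>?D. card {\<pi> \<in> ?P. consecutive (\<pi> ` W) (\<pi> (fst e)) (\<pi> (snd e))})
      = (\<Sum>e\<in>?D. ?N)"
    by (rule sum.cong) (use card_consecutive_at_eq[OF W _ _ _ xy] in auto)
  moreover have "(\<Sum>e\<in>?D. card {\<pi> \<in> ?P. consecutive (\<pi> ` W) (\<pi> (fst e)) (\<pi> (snd e))})
      = (\<Sum>\<pi>\<in>?P. card {e \<in> ?D. consecutive (\<pi> ` W) (\<pi> (fst e)) (\<pi> (snd e))})"
    using finD finP by (intro sum_multicount_gen[symmetric, of ?P ?D]) auto
  moreover have "\<dots> = (\<Sum>\<pi>\<in>?P. card W - 1)"
    by (rule sum.cong) (use per_perm in auto)
  ultimately have "(card W - 1) * (card W * ?N) = (card W - 1) * fact (card A)"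
    using card_permutations[OF refl fin] by (simp add: cardD algebra_simps)
  moreover have "card W - 1 \<noteq> 0"
    using card_mono[OF finW, of "{x, y}"] xy by simp
  ultimately show ?thesis by simp
qed

section \<open>Harmonic sums\<close>

lemma harmonic_window_sum:
  assumes "1 \<le> q"
  shows "(\<Sum>p=1..<q. 1 / (real q - real p + 1)) = (\<Sum>m=1..q. 1 / real m) - 1"
proof -
  have "(\<Sum>p=1..<q. 1 / (real q - real p + 1)) = (\<Sum>m=2..q. 1 / real m)"
    by (rule sum.reindex_bij_witness[of _ "\<lambda>m. q + 1 - m" "\<lambda>p. q + 1 - p"]) auto
  also have "\<dots> = (\<Sum>m=1..q. 1 / real m) - 1"
    using assms sum.atLeast_Suc_atMost[of 1 q "\<lambda>m. 1 / real m"] by (simp add: numeral_2_eq_2)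
  finally show ?thesis .
qed

lemma sum_harmonic:
  "(\<Sum>j=1..n. (\<Sum>m=1..j. 1 / real m) - 1) = (real n + 1) * (\<Sum>m=1..n. 1 / real m) - 2 * real n"
proof (induction n)
  case (Suc n)
  define h where "h = (\<Sum>m=1..n. 1 / real m)"
  have h: "(\<Sum>m=1..Suc n. 1 / real m) = h + 1 / (real n + 1)"
    by (simp add: h_def add.commute)
  have "(\<Sum>j=1..Suc n. (\<Sum>m=1..j. 1 / real m) - 1)
      = (\<Sum>j=1..n. (\<Sum>m=1..j. 1 / real m) - 1) + ((\<Sum>m=1..Suc n. 1 / real m) - 1)"
    by (rule sum.cl_ivl_Suc[THEN trans]) simp
  also have "\<dots> = (real n + 1) * h - 2 * real n + (h + 1 / (real n + 1) - 1)"
    unfolding Suc h by (simp only: h_def)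
  also have "\<dots> = (real (Suc n) + 1) * (h + 1 / (real n + 1)) - 2 * real (Suc n)"
    by (simp add: field_simps)
  finally show ?case unfolding h .
qed simp

text \<open>
  The inner sum is the harmonic number \<open>H\<^bsub>j-1\<^esub>\<close>, so this is the classical
  \<open>H\<^sub>1 + \<dots> + H\<^bsub>i-1\<^esub> = i * (H\<^sub>i - 1)\<close>.
\<close>

lemma double_harmonic_sum:
  assumes "1 \<le> i"
  shows "(\<Sum>j=2..i. \<Sum>k=2..j. 1 / (real k - 1)) = real i * ((\<Sum>m=1..i. 1 / real m) - 1)"
proof -
  have inner: "(\<Sum>k=2..Suc j. 1 / (real k - 1)) = (\<Sum>m=1..j. 1 / real m)" for j
    by (rule sum.reindex_bij_witness[of _ Suc "\<lambda>k. k - 1"]) auto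
  show ?thesis
    using assms
  proof (induction i rule: dec_induct)
    case (step i)
    then have "(\<Sum>j=2..Suc i. \<Sum>k=2..j. 1 / (real k - 1))
        = real i * ((\<Sum>m=1..i. 1 / real m) - 1) + (\<Sum>m=1..i. 1 / real m)"
      using inner[of i] by simp
    moreover have "(real i + 1) * (1 / (real i + 1)) = 1" by simp
    ultimately show ?case by (simp add: algebra_simps)
  qed simp
qed

section \<open>The expected down degree\<close>

text \<open>
  Linearity of expectation, multiplied by \<open>n!\<close>: exchanging the summations over permutations and
  over pairs \<open>p < q\<close> leaves, for each pair, the count \<open>n! / (q - p + 1)\<close> for the window \<open>{p..q}\<close>.
\<close>

lemma sum_card_cover_positions:
  "(\<Sum>\<pi>\<in>sym_group n. real (card (cover_positions n \<pi>)))
     = fact n * (\<Sum>q=1..n. \<Sum>p=1..<q. 1 / (real q - real p + 1))"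
proof -
  let ?D = "Sigma {1..n} (\<lambda>q. {1..<q})"
  let ?C = "\<lambda>\<pi> q p. consecutive (\<pi> ` {p..q}) (\<pi> q) (\<pi> p)"
  have fin: "finite (sym_group n)" by (simp add: sym_group_def finite_permutations)
  have count: "card (cover_positions n \<pi>) = card {e \<in> ?D. ?C \<pi> (fst e) (snd e)}"
    if "\<pi> \<in> sym_group n" for \<pi>
  proof (rule bij_betw_same_card[of prod.swap], rule bij_betw_imageI)
    \<comment> \<open>The window includes its end points, but their values are never strictly in between.\<close>
    have iff: "(p, q) \<in> cover_positions n \<pi> \<longleftrightarrow> (q, p) \<in> ?D \<and> ?C \<pi> q p" for p q
    proof (cases "1 \<le> p \<and> p < q \<and> q \<le> n \<and> \<pi> q < \<pi> p")
      case True
      have "(\<exists>r. p < r \<and> r < q \<and> \<pi> q < \<pi> r \<and> \<pi> r < \<pi> p)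
          \<longleftrightarrow> (\<exists>w\<in>\<pi> ` {p..q}. \<pi> q < w \<and> w < \<pi> p)"
        unfolding bex_simps(7)
        by (metis atLeastAtMost_iff le_neq_implies_less less_imp_le order_less_irrefl)
      with True show ?thesis
        unfolding cover_positions_def consecutive_def by fastforce
    next
      case False
      then show ?thesis by (auto simp: cover_positions_def consecutive_def)
    qed
    show "prod.swap ` cover_positions n \<pi> = {e \<in> ?D. ?C \<pi> (fst e) (snd e)}"
      using iff by force
  qed simp
  have "(\<Sum>\<pi>\<in>sym_group n. card (cover_positions n \<pi>))
      = (\<Sum>\<pi>\<in>sym_group n. card {e \<in> ?D. ?C \<pi> (fst e) (snd e)})"
    by (rule sum.cong) (use count in auto)
  also have "\<dots> = (\<Sum>e\<in>?D. card {\<pi> \<in> sym_group n. ?C \<pi> (fst e) (snd e)})"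
    using fin by (intro sum_multicount_gen) auto
  finally have "(\<Sum>\<pi>\<in>sym_group n. real (card (cover_positions n \<pi>)))
      = (\<Sum>e\<in>?D. real (card {\<pi> \<in> sym_group n. ?C \<pi> (fst e) (snd e)}))"
    by (metis (no_types, lifting) of_nat_sum sum.cong)
  also have "\<dots> = (\<Sum>e\<in>?D. fact n * (1 / (real (fst e) - real (snd e) + 1)))"
  proof (rule sum.cong, simp, clarify)
    fix q p assume qp: "q \<in> {1..n}" "p \<in> {1..<q}"
    have "card {p..q} * card {\<pi>. \<pi> permutes {1..n} \<and> ?C \<pi> q p} = fact (card {1..n})"
      using qp by (intro card_consecutive_at) auto
    then have prod: "real (card {p..q}) * real (card {\<pi> \<in> sym_group n. ?C \<pi> q p}) = fact n"
      by (simp add: sym_group_def flip: of_nat_mult)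
    have size: "real (card {p..q}) = real q - real p + 1" using qp by auto
    have "real (card {\<pi> \<in> sym_group n. ?C \<pi> q p}) * (real q - real p + 1) = fact n"
      using prod unfolding size by (subst mult.commute)
    moreover have "real p < real q" using qp by simp
    then have "real q - real p + 1 \<noteq> 0" by linarith
    ultimately have "real (card {\<pi> \<in> sym_group n. ?C \<pi> q p}) = fact n / (real q - real p + 1)"
      using nonzero_eq_divide_eq by blast
    then show "real (card {\<pi> \<in> sym_group n. ?C \<pi> (fst (q, p)) (snd (q, p))})
        = fact n * (1 / (real (fst (q, p)) - real (snd (q, p)) + 1))"
      by (simp only: fst_conv snd_conv times_divide_eq_right mult_1_right)
  qed
  also have "\<dots> = fact n * (\<Sum>q=1..n. \<Sum>p=1..<q. 1 / (real q - real p + 1))"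
    by (simp add: sum.Sigma sum_distrib_left case_prod_beta)
  finally show ?thesis .
qed

theorem theorem4p1:
  fixes n :: nat
  assumes "n \<ge> 1"
  shows "measure_pmf.expectation (pmf_of_set (sym_group n)) (\<lambda>\<pi>. real (down_degree n \<pi>))
           = (\<Sum>i=2..n. \<Sum>j=2..i. \<Sum>k=2..j. 1 / (real i * (real k - 1)))
       \<and> (\<Sum>i=2..n. \<Sum>j=2..i. \<Sum>k=2..j. 1 / (real i * (real k - 1)))
           = (real n + 1) * (\<Sum>i=1..n. 1 / real i) - 2 * real n"
proof -
  let ?H = "\<lambda>i. \<Sum>m=1..i. 1 / real m"
  have fin: "finite (sym_group n)" by (simp add: sym_group_def finite_permutations)
  have ne: "sym_group n \<noteq> {}" using permutes_id[of "{1..n}"] unfolding sym_group_def by blast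
  have card: "card (sym_group n) = fact n"
    unfolding sym_group_def by (rule card_permutations) auto
  have "measure_pmf.expectation (pmf_of_set (sym_group n)) (\<lambda>\<pi>. real (down_degree n \<pi>))
      = (\<Sum>\<pi>\<in>sym_group n. real (card (cover_positions n \<pi>))) / fact n"
    using fin ne by (simp add: integral_pmf_of_set card down_degree_eq_card_cover_positions)
  also have "\<dots> = (\<Sum>q=1..n. \<Sum>p=1..<q. 1 / (real q - real p + 1))"
    by (simp add: sum_card_cover_positions)
  also have "\<dots> = (\<Sum>q=1..n. ?H q - 1)"
    by (rule sum.cong) (use harmonic_window_sum in auto)
  finally have E: "measure_pmf.expectation (pmf_of_set (sym_group n)) (\<lambda>\<pi>. real (down_degree n \<pi>))
      = (\<Sum>q=1..n. ?H q - 1)" .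
  have "(\<Sum>i=2..n. \<Sum>j=2..i. \<Sum>k=2..j. 1 / (real i * (real k - 1))) = (\<Sum>i=2..n. ?H i - 1)"
  proof (rule sum.cong[OF refl])
    fix i assume "i \<in> {2..n}"
    then have i: "1 \<le> i" by simp
    have "(\<Sum>j=2..i. \<Sum>k=2..j. 1 / (real i * (real k - 1)))
        = (\<Sum>j=2..i. \<Sum>k=2..j. 1 / (real k - 1)) / real i"
      by (simp add: sum_divide_distrib mult.commute)
    also have "\<dots> = ?H i - 1" using double_harmonic_sum[OF i] i by simp
    finally show "(\<Sum>j=2..i. \<Sum>k=2..j. 1 / (real i * (real k - 1))) = ?H i - 1" .
  qed
  also have "\<dots> = (\<Sum>i=1..n. ?H i - 1)"
    using assms sum.atLeast_Suc_atMost[of 1 n "\<lambda>i. ?H i - 1"] by (simp add: numeral_2_eq_2)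
  finally have T: "(\<Sum>i=2..n. \<Sum>j=2..i. \<Sum>k=2..j. 1 / (real i * (real k - 1)))
      = (\<Sum>i=1..n. ?H i - 1)" .
  show ?thesis unfolding E T sum_harmonic by simp
qed

end
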